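(* Let $n\ge 0$ and $0\le k\le n+1$ be integers and let $\mu$ be a locally uniformly distributed measure in $\mathbb{R}^{n+1}$. Assume there are a point $z_0\in\operatorname{supp}\mu$, a radius $r_0>0$ and a $k$-plane $P\subset\mathbb{R}^{n+1}$ such that the open ball $B(z_0,r_0)$ satisfies $B(z_0,r_0)\cap\operatorname{supp}\mu=B(z_0,r_0)\cap P$. Then there is a unique connected component of $\operatorname{supp}\mu$ which has nonempty intersection with $B(z_0,r_0)$, and this connected component is the $k$-plane $P$.
   Context: $B(x,r)$ denotes the open Euclidean ball in $\mathbb{R}^{n+1}$ of center $x$ and radius $r$. A Radon measure $\mu$ on $\mathbb{R}^{n+1}$ is locally uniformly distributed if $0<\mu(B(x,r))=\mu(B(y,r))<\infty$ whenever $x,y\in\operatorname{supp}\mu$ and $0<r\le 1$. A $k$-plane is a $k$-dimensional affine subspace of $\mathbb{R}^{n+1}$. *)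

theory Defs
  imports "HOL-Analysis.Analysis"
begin

(* The regularity clauses are automatic on R^n for a Borel measure that is finite on
   compact sets; they are kept so that this is the usual definition of a Radon measure. *)
definition radon_measure :: "'a::topological_space measure \<Rightarrow> bool" where
  "radon_measure \<mu> \<longleftrightarrow>
     sets \<mu> = sets borel \<and>
     (\<forall>K. compact K \<longrightarrow> emeasure \<mu> K < \<infinity>) \<and>
     (\<forall>A\<in>sets borel. emeasure \<mu> A = (INF U\<in>{U. open U \<and> A \<subseteq> U}. emeasure \<mu> U)) \<and>
     (\<forall>U. open U \<longrightarrow> emeasure \<mu> U = (SUP K\<in>{K. compact K \<and> K \<subseteq> U}. emeasure \<mu> K))"

definition supp_measure :: "'a::metric_space measure \<Rightarrow> 'a set" where
  "supp_measure \<mu> = {x. \<forall>r>0. emeasure \<mu> (ball x r) > 0}"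

definition locally_uniformly_distributed :: "'a::metric_space measure \<Rightarrow> bool" where
  "locally_uniformly_distributed \<mu> \<longleftrightarrow>
     radon_measure \<mu> \<and>
     (\<forall>x\<in>supp_measure \<mu>. \<forall>y\<in>supp_measure \<mu>. \<forall>r. 0 < r \<and> r \<le> 1 \<longrightarrow>
        0 < emeasure \<mu> (ball x r) \<and>
        emeasure \<mu> (ball x r) = emeasure \<mu> (ball y r) \<and>
        emeasure \<mu> (ball y r) < \<infinity>)"

(* aff_dim {} = -1, so a k-plane is nonempty. *)
definition k_plane :: "nat \<Rightarrow> 'a::euclidean_space set \<Rightarrow> bool" where
  "k_plane k P \<longleftrightarrow> affine P \<and> aff_dim P = int k"

end

theory Submission
  imports Defs
begin

text \<open>Call \<open>a \<in> P\<close> good if \<open>P\<close> near \<open>a\<close> is contained in the support, and let \<open>R = min 1 r\<^sub>0\<close>. For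
  a good point \<open>a\<close> compare \<open>\<mu>\<close> with its translate \<open>\<nu>\<close> that moves \<open>z\<^sub>0\<close> to \<open>a\<close>. By uniformity,
  the functions \<open>x \<mapsto> \<integral> max 0 (R\<^sup>2 - |x - z|\<^sup>2)\<^sup>j\<close> for \<open>\<mu>\<close> and for \<open>\<nu>\<close> agree on a neighbourhood of
  \<open>a\<close> in \<open>P\<close>. Differentiating along \<open>P\<close>, the integrals remain equal after multiplication by any
  polynomial in the component of \<open>z\<close> tangent to \<open>P\<close> and in \<open>|a - z|\<^sup>2\<close>. Polynomials peaked at a
  point of \<open>P\<close> show that the two supports have the same points on \<open>P\<close> in the ball of radius \<open>R\<close>
  around \<open>a\<close>, and the squared distance to \<open>P\<close> shows that \<open>\<mu>\<close> does not charge the rest of that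
  ball. So the support coincides with \<open>P\<close> in a ball of uniform radius \<open>R\<close> around every good
  point. Hence all points of \<open>P\<close> are good, and \<open>P\<close> is open and closed in the support.\<close>

section \<open>Locally finite Borel measures and truncated quadratic bumps\<close>

text \<open>Only finiteness on balls enters the integrations below, and this property passes
  directly to translates.\<close>

definition locally_finite_borel :: "'a::euclidean_space measure \<Rightarrow> bool" where
  "locally_finite_borel M \<longleftrightarrow> sets M = sets borel \<and> (\<forall>x r. emeasure M (cball x r) < \<infinity>)"

text \<open>The distance is squared so that, where the bump is positive, its derivative in the
  centre \<open>x\<close> is linear in \<open>z\<close>, and \<open>(dist x z)\<^sup>2\<close>
  equals \<open>R\<^sup>2\<close> minus the bump.\<close>

definition bump :: "real \<Rightarrow> 'a::euclidean_space \<Rightarrow> 'a \<Rightarrow> real" where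
  "bump R x z = max 0 (R\<^sup>2 - (dist x z)\<^sup>2)"

lemma bump_nonneg: "0 \<le> bump R x z"
  by (simp add: bump_def)

lemma bump_le_one:
  assumes "0 \<le> R" "R \<le> 1"
  shows "bump R x z \<le> 1"
proof -
  have "R\<^sup>2 \<le> 1"
    using assms by (simp add: power_le_one)
  then show ?thesis
    unfolding bump_def by (smt (verit) zero_le_power2)
qed

lemma bump_eq_0:
  assumes "0 \<le> R" "R \<le> dist x z"
  shows "bump R x z = 0"
  using assms by (simp add: bump_def power_mono max_def)

lemma bump_pos:
  assumes "dist x z < R"
  shows "bump R x z > 0"
  using assms by (simp add: bump_def power_strict_mono less_max_iff_disj)

lemma continuous_on_bump [continuous_intros]: "continuous_on S (bump R x)"
  unfolding bump_def by (intro continuous_intros)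

lemma locally_finite_borel_measurable:
  fixes g :: "'a::euclidean_space \<Rightarrow> real"
  assumes "locally_finite_borel M" "continuous_on UNIV g"
  shows "g \<in> borel_measurable M"
proof -
  have "sets M = sets borel"
    using assms(1) by (simp add: locally_finite_borel_def)
  then show ?thesis
    using borel_measurable_continuous_onI[OF assms(2)] measurable_cong_sets[of M borel borel borel] by blast
qed

lemma locally_finite_borel_integrable:
  fixes g :: "'a::euclidean_space \<Rightarrow> real"
  assumes M: "locally_finite_borel M" and g: "continuous_on UNIV g"
    and zero: "\<And>z. r \<le> dist x z \<Longrightarrow> g z = 0"
  shows "integrable M g"
proof -
  have "compact (g ` cball x r)"
    by (intro compact_continuous_image continuous_on_subset[OF g]) auto
  then obtain B where B: "\<And>z. z \<in> cball x r \<Longrightarrow> norm (g z) \<le> B"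
    by (metis bounded_iff compact_imp_bounded imageI)
  show ?thesis
  proof (rule integrableI_bounded_set[where A = "cball x r" and B = B])
    show "cball x r \<in> sets M" "emeasure M (cball x r) < \<infinity>"
      using M by (auto simp: locally_finite_borel_def)
    show "g \<in> borel_measurable M"
      using M g by (rule locally_finite_borel_measurable)
  qed (use B zero in auto)
qed

text \<open>The exponent is written \<open>Suc j\<close> because only positive powers vanish outside
  the ball; this convention persists throughout.\<close>

lemma integrable_bump:
  assumes "locally_finite_borel M" "continuous_on UNIV p" "0 \<le> R"
  shows "integrable M (\<lambda>z. p z * bump R x z ^ Suc j)"
  by (rule locally_finite_borel_integrable[where x = x and r = R])
    (use assms in \<open>auto intro!: continuous_intros simp: bump_eq_0\<close>)

section \<open>Directional derivatives of bump integrals with respect to the centre\<close>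

text \<open>An exponent of at least two smooths the kink: at 0 the difference quotient is bounded by
  a positive power of \<open>\<bar>h\<bar>\<close>.\<close>

lemma has_derivative_positive_part_power:
  fixes s :: real
  shows "((\<lambda>s. max 0 s ^ Suc (Suc j)) has_real_derivative real (Suc (Suc j)) * max 0 s ^ Suc j) (at s)"
proof (cases s "0 :: real" rule: linorder_cases)
  case less
  have ev: "\<forall>\<^sub>F t in nhds s. max 0 t ^ Suc (Suc j) = (0::real)"
    using eventually_nhds_in_open[of "{..<0}" s] less
    by (auto elim!: eventually_mono)
  have "((\<lambda>t. max 0 t ^ Suc (Suc j)) has_real_derivative 0) (at s)"
    by (subst DERIV_cong_ev[OF refl ev refl]) simp
  then show ?thesis using less by simp
next
  case greater
  have ev: "\<forall>\<^sub>F t in nhds s. max 0 t ^ Suc (Suc j) = t ^ Suc (Suc j)"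
    using eventually_nhds_in_open[of "{0<..}" s] greater
    by (auto elim!: eventually_mono)
  have "((\<lambda>t. max 0 t ^ Suc (Suc j)) has_real_derivative real (Suc (Suc j)) * s ^ Suc j) (at s)"
    by (subst DERIV_cong_ev[OF refl ev refl])
      (use DERIV_pow[of "Suc (Suc j)" s] in simp)
  then show ?thesis using greater by simp
next
  case equal
  have "((\<lambda>h::real. (max 0 h ^ Suc (Suc j)) / h) \<longlongrightarrow> 0) (at 0)"
  proof (rule Lim_null_comparison)
    show "\<forall>\<^sub>F h in at 0. norm ((max 0 h ^ Suc (Suc j)) / h) \<le> \<bar>h\<bar> ^ Suc j"
      by (rule always_eventually) (auto simp: max_def abs_mult power_abs mult_nonpos_nonneg)
    show "((\<lambda>h::real. \<bar>h\<bar> ^ Suc j) \<longlongrightarrow> 0) (at 0)"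
      by (rule tendsto_eq_intros | simp)+
  qed
  then show ?thesis using equal by (simp add: has_field_derivative_iff)
qed

lemma dist_add_squared:
  fixes x z e :: "'a::real_inner"
  shows "(dist (x + t *\<^sub>R e) z)\<^sup>2 = (dist x z)\<^sup>2 - 2 * t * (e \<bullet> (z - x)) + t\<^sup>2 * (norm e)\<^sup>2"
  unfolding dist_norm power2_norm_eq_inner
  by (simp add: algebra_simps inner_commute power2_eq_square)

text \<open>Moving the centre along \<open>e\<close> lowers the exponent by one and produces the
  linear weight \<open>e \<bullet> (z - x)\<close>; this is how polynomial weights arise.\<close>

lemma bump_power_has_derivative:
  "((\<lambda>t. bump R (x + t *\<^sub>R e) z ^ Suc (Suc j)) has_real_derivative
     2 * real (Suc (Suc j)) * ((e \<bullet> (z - x)) * bump R x z ^ Suc j)) (at 0)"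
proof -
  let ?s = "\<lambda>t. R\<^sup>2 - ((dist x z)\<^sup>2 - 2 * t * (e \<bullet> (z - x)) + t\<^sup>2 * (norm e)\<^sup>2)"
  have "(?s has_real_derivative 2 * (e \<bullet> (z - x))) (at 0)"
    by (auto intro!: derivative_eq_intros)
  from DERIV_chain2[OF has_derivative_positive_part_power[of j "?s 0"] this]
  show ?thesis
    by (simp add: bump_def dist_add_squared algebra_simps)
qed

text \<open>Supplies the dominating function for differentiation under the integral: the bound is
  uniform in \<open>t\<close>, and for \<open>t \<le> 1\<close> both bumps live in one fixed compact
  ball.\<close>

lemma bump_power_lipschitz:
  assumes R: "0 \<le> R" "R \<le> 1" and t: "0 < t" "t \<le> 1"
  shows "\<bar>bump R (x + t *\<^sub>R e) z ^ j - bump R x z ^ j\<bar> / t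
           \<le> real j * (2 * (R + norm e) * norm e + (norm e)\<^sup>2) * indicator (cball x (R + norm e)) z"
proof (cases "dist x z \<le> R + norm e")
  case True
  \<comment> \<open>Since \<open>R \<le> 1\<close>, both bumps lie between 0 and 1, where the
    \<open>j\<close>-th power is Lipschitz with constant \<open>j\<close>.\<close>
  have "\<bar>bump R (x + t *\<^sub>R e) z ^ j - bump R x z ^ j\<bar> \<le> real j * \<bar>bump R (x + t *\<^sub>R e) z - bump R x z\<bar>"
    using norm_power_diff[of "bump R (x + t *\<^sub>R e) z" "bump R x z" j] R
    by (simp add: bump_le_one bump_nonneg)
  also have "\<dots> \<le> real j * \<bar>(dist (x + t *\<^sub>R e) z)\<^sup>2 - (dist x z)\<^sup>2\<bar>"
    by (intro mult_left_mono) (auto simp: bump_def)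
  also have "\<dots> = real j * \<bar>- 2 * t * (e \<bullet> (z - x)) + t\<^sup>2 * (norm e)\<^sup>2\<bar>"
    by (simp add: dist_add_squared)
  also have "\<dots> \<le> real j * (t * (2 * (R + norm e) * norm e + (norm e)\<^sup>2))"
  proof (intro mult_left_mono)
    have "\<bar>e \<bullet> (z - x)\<bar> \<le> norm e * (R + norm e)"
      using Cauchy_Schwarz_ineq2[of e "z - x"] True
      by (smt (verit) dist_commute dist_norm mult_left_mono norm_ge_zero)
    then have 1: "2 * t * \<bar>e \<bullet> (z - x)\<bar> \<le> 2 * t * (norm e * (R + norm e))"
      using t by (intro mult_left_mono) auto
    have 2: "t\<^sup>2 * (norm e)\<^sup>2 \<le> t * (norm e)\<^sup>2"
      using t by (intro mult_right_mono) (auto simp: power2_eq_square mult_left_le)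
    have "\<bar>- 2 * t * (e \<bullet> (z - x)) + t\<^sup>2 * (norm e)\<^sup>2\<bar> \<le> \<bar>2 * t * (e \<bullet> (z - x))\<bar> + t\<^sup>2 * (norm e)\<^sup>2"
      by (smt (verit) mult_minus_left zero_le_mult_iff zero_le_power2)
    also have "\<dots> = 2 * t * \<bar>e \<bullet> (z - x)\<bar> + t\<^sup>2 * (norm e)\<^sup>2"
      using t by (simp add: abs_mult)
    finally have 3: "\<bar>- 2 * t * (e \<bullet> (z - x)) + t\<^sup>2 * (norm e)\<^sup>2\<bar> \<le> 2 * t * \<bar>e \<bullet> (z - x)\<bar> + t\<^sup>2 * (norm e)\<^sup>2" .
    have 4: "t * (2 * (R + norm e) * norm e + (norm e)\<^sup>2) = 2 * t * (norm e * (R + norm e)) + t * (norm e)\<^sup>2"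
      by (simp add: algebra_simps)
    show "\<bar>- 2 * t * (e \<bullet> (z - x)) + t\<^sup>2 * (norm e)\<^sup>2\<bar> \<le> t * (2 * (R + norm e) * norm e + (norm e)\<^sup>2)"
      using 1 2 3 unfolding 4 by linarith
  qed simp
  finally show ?thesis
    using True t by (simp add: divide_le_eq ac_simps)
next
  case False
  have "dist x z \<le> dist (x + t *\<^sub>R e) z + dist x (x + t *\<^sub>R e)"
    by (metis add.commute dist_triangle)
  moreover have "dist x (x + t *\<^sub>R e) \<le> norm e"
    using t by (simp add: dist_norm mult_left_le_one_le)
  moreover have "0 \<le> norm e" by simp
  ultimately have "bump R (x + t *\<^sub>R e) z = 0" "bump R x z = 0"
    using False R(1) by (intro bump_eq_0; linarith)+
  then show ?thesis
    using False by simp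
qed

text \<open>Dominated convergence, with the Lipschitz bound above times a bound for \<open>p\<close>
  on the compact ball. The derivative is taken along a sequence to fit that theorem.\<close>

lemma integral_bump_derivative:
  fixes M :: "'a::euclidean_space measure"
  assumes M: "locally_finite_borel M" and p: "continuous_on UNIV p" and R: "0 \<le> R" "R \<le> 1"
    and t: "\<And>n. 0 < t n" "\<And>n. t n \<le> 1" "t \<longlonglongrightarrow> 0"
  shows "(\<lambda>n. ((\<integral>z. p z * bump R (x + t n *\<^sub>R e) z ^ Suc (Suc j) \<partial>M)
              - (\<integral>z. p z * bump R x z ^ Suc (Suc j) \<partial>M)) / t n)
         \<longlonglongrightarrow> 2 * real (Suc (Suc j)) * (\<integral>z. p z * (e \<bullet> (z - x)) * bump R x z ^ Suc j \<partial>M)"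
proof -
  let ?C = "cball x (R + norm e)"
  let ?L = "real (Suc (Suc j)) * (2 * (R + norm e) * norm e + (norm e)\<^sup>2)"
  let ?s = "\<lambda>n z. p z * ((bump R (x + t n *\<^sub>R e) z ^ Suc (Suc j) - bump R x z ^ Suc (Suc j)) / t n)"
  let ?f = "\<lambda>z. 2 * real (Suc (Suc j)) * (p z * (e \<bullet> (z - x)) * bump R x z ^ Suc j)"
  have "compact (p ` ?C)"
    by (intro compact_continuous_image continuous_on_subset[OF p]) auto
  then obtain K where K: "\<And>z. z \<in> ?C \<Longrightarrow> \<bar>p z\<bar> \<le> K"
    by (metis bounded_iff compact_imp_bounded imageI real_norm_def)
  have "(\<lambda>n. integral\<^sup>L M (?s n)) \<longlonglongrightarrow> integral\<^sup>L M ?f"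
  proof (rule integral_dominated_convergence[where w = "\<lambda>z. indicator ?C z * (K * ?L)"])
    show "?f \<in> borel_measurable M" "\<And>n. ?s n \<in> borel_measurable M"
      unfolding divide_inverse
      by (rule locally_finite_borel_measurable[OF M]; intro continuous_intros p)+
    show "integrable M (\<lambda>z. indicator ?C z * (K * ?L))"
      using M unfolding locally_finite_borel_def
      by (intro integrable_mult_left integrable_real_indicator) auto
    show "AE z in M. (\<lambda>n. ?s n z) \<longlonglongrightarrow> ?f z"
    proof (rule AE_I2)
      fix z
      have "((\<lambda>h. (bump R (x + h *\<^sub>R e) z ^ Suc (Suc j) - bump R x z ^ Suc (Suc j)) / h) \<longlongrightarrow>
               2 * real (Suc (Suc j)) * ((e \<bullet> (z - x)) * bump R x z ^ Suc j)) (at 0)"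
        using bump_power_has_derivative[of R x e z j]
        unfolding has_field_derivative_iff by simp
      moreover have "filterlim t (at 0) sequentially"
        using t by (simp add: filterlim_at less_imp_neq[THEN not_sym])
      ultimately have "(\<lambda>n. (bump R (x + t n *\<^sub>R e) z ^ Suc (Suc j) - bump R x z ^ Suc (Suc j)) / t n) \<longlonglongrightarrow>
               2 * real (Suc (Suc j)) * ((e \<bullet> (z - x)) * bump R x z ^ Suc j)"
        by (rule filterlim_compose)
      from tendsto_mult_left[OF this, of "p z"]
      show "(\<lambda>n. ?s n z) \<longlonglongrightarrow> ?f z"
        by (simp only: ac_simps)
    qed
    show "AE z in M. norm (?s n z) \<le> indicator ?C z * (K * ?L)" for n
    proof (rule AE_I2)
      fix z
      have "norm (?s n z) = \<bar>p z\<bar> * (\<bar>bump R (x + t n *\<^sub>R e) z ^ Suc (Suc j) - bump R x z ^ Suc (Suc j)\<bar> / t n)"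
        using t(1)[of n] by (simp add: abs_mult)
      also have "\<dots> \<le> \<bar>p z\<bar> * (?L * indicator ?C z)"
        by (intro mult_left_mono bump_power_lipschitz R t) simp
      also have "\<dots> \<le> indicator ?C z * (K * ?L)"
      proof (cases "z \<in> ?C")
        case True
        have "0 \<le> ?L" using R(1) by (intro mult_nonneg_nonneg add_nonneg_nonneg) auto
        then show ?thesis using True K[OF True] by (simp add: mult_right_mono)
      qed simp
      finally show "norm (?s n z) \<le> indicator ?C z * (K * ?L)" .
    qed
  qed
  moreover have "integral\<^sup>L M ?f = 2 * real (Suc (Suc j)) * (\<integral>z. p z * (e \<bullet> (z - x)) * bump R x z ^ Suc j \<partial>M)"
    by simp
  moreover have "integral\<^sup>L M (?s n) = ((\<integral>z. p z * bump R (x + t n *\<^sub>R e) z ^ Suc (Suc j) \<partial>M)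
              - (\<integral>z. p z * bump R x z ^ Suc (Suc j) \<partial>M)) / t n" for n
  proof -
    have "?s n = (\<lambda>z. (p z * bump R (x + t n *\<^sub>R e) z ^ Suc (Suc j) - p z * bump R x z ^ Suc (Suc j)) / t n)"
      by (auto simp: fun_eq_iff algebra_simps diff_divide_distrib)
    then show ?thesis
      by (simp only: integral_divide_zero Bochner_Integration.integral_diff[OF integrable_bump[OF M p R(1)] integrable_bump[OF M p R(1)]])
  qed
  ultimately show ?thesis by (simp only:)
qed

section \<open>Supports of measures and orthogonal projection\<close>

text \<open>The complement of the support is a union of null balls, and by Lindelof countably many
  of them suffice.\<close>

lemma AE_in_supp_measure:
  fixes M :: "'a::euclidean_space measure"
  assumes "sets M = sets borel"
  shows "AE z in M. z \<in> supp_measure M"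
proof -
  let ?F = "{ball x r |x r. 0 < r \<and> emeasure M (ball x r) = 0}"
  obtain F where F: "F \<subseteq> ?F" "countable F" "\<Union>F = \<Union>?F"
    by (rule Lindelof[of ?F]) auto
  have "(\<Union>S\<in>F. S) \<in> null_sets M"
    using F(1,2) assms by (intro null_sets_UN') (auto intro!: null_setsI)
  moreover have "z \<in> \<Union>?F" if "z \<notin> supp_measure M" for z
  proof -
    obtain r where "0 < r" "emeasure M (ball z r) = 0"
      using \<open>z \<notin> supp_measure M\<close> by (auto simp: supp_measure_def)
    then show ?thesis
      by (intro UnionI[of "ball z r"]) auto
  qed
  ultimately show ?thesis
    using F(3) by (intro AE_I'[of "\<Union>F"]) auto
qed

lemma integral_zero_imp_zero_on_supp:
  fixes M :: "'a::euclidean_space measure" and g :: "'a \<Rightarrow> real"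
  assumes M: "sets M = sets borel" and g: "continuous_on UNIV g" "\<And>z. 0 \<le> g z" "integrable M g"
    and zero: "integral\<^sup>L M g = 0" and w: "w \<in> supp_measure M"
  shows "g w = 0"
proof (rule ccontr)
  assume "g w \<noteq> 0"
  then have "w \<in> {z. 0 < g z}"
    using g(2)[of w] by simp
  moreover have "open {z. 0 < g z}"
    using g(1) by (simp add: open_Collect_less)
  ultimately obtain \<delta> where \<delta>: "0 < \<delta>" "ball w \<delta> \<subseteq> {z. 0 < g z}"
    using openE by blast
  have "AE z in M. g z = 0"
    using integral_nonneg_eq_0_iff_AE[OF g(3)] g(2) zero by simp
  then have "AE z in M. z \<notin> ball w \<delta>"
    by eventually_elim (use \<delta> in force)
  then have "emeasure M (ball w \<delta>) = 0"
    using M by (subst (asm) AE_iff_measurable[of "ball w \<delta>"]) (auto simp: sets_eq_imp_space_eq[OF M])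
  then show False
    using w \<delta>(1) by (auto simp: supp_measure_def)
qed

text \<open>Pythagoras for the projection onto \<open>span B\<close>. It links the squared distance
  to a plane, which shows nonnegativity, with a polynomial in inner products, which is an admissible
  weight.\<close>

lemma bessel:
  fixes y :: "'a::euclidean_space"
  assumes B: "finite B" "pairwise orthogonal B" "\<And>e. e \<in> B \<Longrightarrow> norm e = 1"
  shows "(norm (y - (\<Sum>e\<in>B. (e \<bullet> y) *\<^sub>R e)))\<^sup>2 = (norm y)\<^sup>2 - (\<Sum>e\<in>B. (e \<bullet> y)\<^sup>2)"
proof -
  have inner_B: "e \<bullet> f = (if e = f then 1 else 0)" if "e \<in> B" "f \<in> B" for e f
    using that B(2,3) by (auto simp: pairwise_def orthogonal_def dot_square_norm)
  let ?s = "\<Sum>e\<in>B. (e \<bullet> y) *\<^sub>R e"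
  have ys: "y \<bullet> ?s = (\<Sum>e\<in>B. (e \<bullet> y)\<^sup>2)"
    by (simp add: inner_sum_right power2_eq_square inner_commute)
  have "f \<bullet> ?s = f \<bullet> y" if "f \<in> B" for f
  proof -
    have "f \<bullet> ?s = (\<Sum>e\<in>B. if f = e then e \<bullet> y else 0)"
      unfolding inner_sum_right by (intro sum.cong refl) (use that inner_B in auto)
    then show ?thesis using that B(1) by simp
  qed
  then have "?s \<bullet> ?s = (\<Sum>e\<in>B. (e \<bullet> y)\<^sup>2)"
    by (simp add: inner_sum_left power2_eq_square cong: sum.cong)
  then show ?thesis
    unfolding power2_norm_eq_inner
    using ys by (simp add: inner_diff inner_commute[of ?s y])
qed

section \<open>Two measures with equal bump integrals along a plane\<close>

text \<open>The plane is \<open>a + T\<close>. By differentiating \<open>eq\<close> in directions of \<open>T\<close>, it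
  propagates to weights \<open>p z * bump R x z ^ Suc j\<close> for all \<open>p\<close> generated by \<open>e \<bullet> z\<close> with
  \<open>e \<in> T\<close> and \<open>(dist w z)\<^sup>2\<close> with \<open>w \<in> a + T\<close>.\<close>

locale equal_bump_integrals =
  fixes M N :: "'a::euclidean_space measure" and R :: real and T :: "'a set" and a :: 'a and \<epsilon> :: real
  assumes M: "locally_finite_borel M" and N: "locally_finite_borel N"
    and R: "0 < R" "R \<le> 1"
    and T: "subspace T"
    and \<epsilon>: "0 < \<epsilon>"
    and eq: "\<And>x j. x - a \<in> T \<Longrightarrow> dist a x < \<epsilon> \<Longrightarrow>
               (\<integral>z. bump R x z ^ Suc j \<partial>M) = (\<integral>z. bump R x z ^ Suc j \<partial>N)"
begin

text \<open>Quantifying over all nearby centres \<open>x\<close> and all exponents makes the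
  property stable under differentiation in \<open>x\<close> and under multiplication by the bump.
  Continuity is included to guarantee integrability.\<close>

definition agrees :: "('a \<Rightarrow> real) \<Rightarrow> bool" where
  "agrees p \<longleftrightarrow> continuous_on UNIV p \<and> (\<forall>x j. x - a \<in> T \<longrightarrow> dist a x < \<epsilon> \<longrightarrow>
     (\<integral>z. p z * bump R x z ^ Suc j \<partial>M) = (\<integral>z. p z * bump R x z ^ Suc j \<partial>N))"

lemma agreesI:
  assumes "continuous_on UNIV p"
    and "\<And>x j. x - a \<in> T \<Longrightarrow> dist a x < \<epsilon> \<Longrightarrow>
      (\<integral>z. p z * bump R x z ^ Suc j \<partial>M) = (\<integral>z. p z * bump R x z ^ Suc j \<partial>N)"
  shows "agrees p"
  using assms by (simp add: agrees_def)

lemma agreesD: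
  assumes "agrees p" "x - a \<in> T" "dist a x < \<epsilon>"
  shows "(\<integral>z. p z * bump R x z ^ Suc j \<partial>M) = (\<integral>z. p z * bump R x z ^ Suc j \<partial>N)"
  using assms unfolding agrees_def by blast

lemma agrees_continuous: "agrees p \<Longrightarrow> continuous_on UNIV p"
  by (simp add: agrees_def)

lemma integrable_bump_MN:
  assumes "continuous_on UNIV p"
  shows "integrable M (\<lambda>z. p z * bump R x z ^ Suc j)" "integrable N (\<lambda>z. p z * bump R x z ^ Suc j)"
  using integrable_bump[OF M assms] integrable_bump[OF N assms] R by simp_all

lemma agrees_const: "agrees (\<lambda>z. c)"
  by (rule agreesI) (use eq in simp_all)

lemma agrees_cmult:
  assumes "agrees p"
  shows "agrees (\<lambda>z. c * p z)"
proof (rule agreesI)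
  show "continuous_on UNIV (\<lambda>z. c * p z)"
    by (intro continuous_intros agrees_continuous assms)
qed (use agreesD[OF assms] in \<open>simp only: mult.assoc integral_mult_right_zero\<close>)

lemma agrees_add:
  assumes "agrees p" "agrees q"
  shows "agrees (\<lambda>z. p z + q z)"
proof (rule agreesI)
  note pq = assms[THEN agrees_continuous]
  show "continuous_on UNIV (\<lambda>z. p z + q z)"
    by (intro continuous_intros pq)
  show "(\<integral>z. (p z + q z) * bump R x z ^ Suc j \<partial>M) = (\<integral>z. (p z + q z) * bump R x z ^ Suc j \<partial>N)"
    if "x - a \<in> T" "dist a x < \<epsilon>" for x j
    by (simp only: distrib_right Bochner_Integration.integral_add integrable_bump_MN[OF pq(1)]
        integrable_bump_MN[OF pq(2)] agreesD[OF assms(1) that] agreesD[OF assms(2) that])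
qed

lemma agrees_diff:
  assumes "agrees p" "agrees q"
  shows "agrees (\<lambda>z. p z - q z)"
  using agrees_add[OF assms(1) agrees_cmult[OF assms(2), of "-1"]] by simp

lemma agrees_sum:
  assumes "\<And>i. i \<in> I \<Longrightarrow> agrees (p i)"
  shows "agrees (\<lambda>z. \<Sum>i\<in>I. p i z)"
  using assms by (induction I rule: infinite_finite_induct) (auto simp: agrees_const intro!: agrees_add)

text \<open>Differentiate the identity with exponent \<open>Suc (Suc j)\<close> at \<open>x\<close>
  in the direction \<open>e\<close>, which keeps the centre in the plane. The new weight still
  depends on \<open>x\<close>, so this is not yet an instance of \<open>agrees\<close>.\<close>

lemma agrees_mult_inner_centre:
  assumes p: "agrees p" and e: "e \<in> T" and x: "x - a \<in> T" "dist a x < \<epsilon>"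
  shows "(\<integral>z. p z * (e \<bullet> (z - x)) * bump R x z ^ Suc j \<partial>M) =
         (\<integral>z. p z * (e \<bullet> (z - x)) * bump R x z ^ Suc j \<partial>N)"
proof -
  let ?\<eta> = "\<epsilon> - dist a x"
  \<comment> \<open>A step length that keeps the moved centres within \<open>\<epsilon>\<close> of
    \<open>a\<close>; the summand 1 covers \<open>e = 0\<close>.\<close>
  define s where "s = min 1 (?\<eta> / (norm e + 1))"
  have s: "0 < s" "s \<le> 1" "s * norm e < ?\<eta>"
  proof -
    have pos: "0 < ?\<eta>" "0 < norm e + 1"
      using x(2) by (simp_all add: add_nonneg_pos)
    then show "0 < s" "s \<le> 1"
      by (simp_all add: s_def)
    have "s * (norm e + 1) \<le> ?\<eta>"
      using pos by (simp add: s_def flip: pos_le_divide_eq)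
    then show "s * norm e < ?\<eta>"
      using \<open>0 < s\<close> by (simp add: algebra_simps)
  qed
  define t where "t n = s / real (Suc n)" for n
  have t: "0 < t n" "t n \<le> 1" "t n \<le> s" for n
  proof -
    show "0 < t n" using s(1) by (simp add: t_def)
    show "t n \<le> s" using s(1) by (simp add: t_def field_simps)
    then show "t n \<le> 1" using s(2) by simp
  qed
  have t0: "t \<longlonglongrightarrow> 0"
    unfolding t_def using LIMSEQ_Suc[OF lim_const_over_n[of s]] by simp
  have shift: "(\<integral>z. p z * bump R (x + t n *\<^sub>R e) z ^ Suc (Suc j) \<partial>M) =
               (\<integral>z. p z * bump R (x + t n *\<^sub>R e) z ^ Suc (Suc j) \<partial>N)" for n
  proof (rule agreesD[OF p])
    have "(x - a) + t n *\<^sub>R e \<in> T"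
      using T x(1) e by (simp add: subspace_add subspace_scale)
    then show "x + t n *\<^sub>R e - a \<in> T"
      by (simp add: algebra_simps)
    have "dist a (x + t n *\<^sub>R e) \<le> dist a x + dist x (x + t n *\<^sub>R e)"
      by (rule dist_triangle)
    also have "dist x (x + t n *\<^sub>R e) = t n * norm e"
      using t(1)[of n] by (simp add: dist_norm)
    also have "\<dots> \<le> s * norm e"
      using t(3) by (simp add: mult_right_mono)
    finally show "dist a (x + t n *\<^sub>R e) < \<epsilon>"
      using s(3) by simp
  qed
  note lim = integral_bump_derivative[OF _ agrees_continuous[OF p] less_imp_le[OF R(1)] R(2) t(1,2) t0, of _ x e j]
  have "2 * real (Suc (Suc j)) * (\<integral>z. p z * (e \<bullet> (z - x)) * bump R x z ^ Suc j \<partial>M) =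
        2 * real (Suc (Suc j)) * (\<integral>z. p z * (e \<bullet> (z - x)) * bump R x z ^ Suc j \<partial>N)"
    using lim[OF M] lim[OF N] unfolding shift agreesD[OF p x] by (rule LIMSEQ_unique)
  then show ?thesis
    by (simp only: mult_cancel_left) simp
qed

text \<open>Replacing \<open>x\<close> by a fixed \<open>c\<close> changes the weight by the
  constant \<open>e \<bullet> (x - c)\<close> times \<open>p\<close>, so the rule can be
  iterated.\<close>

lemma agrees_mult_inner:
  assumes p: "agrees p" and e: "e \<in> T"
  shows "agrees (\<lambda>z. p z * (e \<bullet> (z - c)))"
proof (rule agreesI)
  note cont = agrees_continuous[OF p]
  show "continuous_on UNIV (\<lambda>z. p z * (e \<bullet> (z - c)))"
    by (intro continuous_intros cont)
  fix x j assume x: "x - a \<in> T" "dist a x < \<epsilon>"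
  have cont': "continuous_on UNIV (\<lambda>z. p z * (e \<bullet> (z - x)))"
    by (intro continuous_intros cont)
  have expand: "(\<integral>z. p z * (e \<bullet> (z - c)) * bump R x z ^ Suc j \<partial>L) =
      (\<integral>z. p z * (e \<bullet> (z - x)) * bump R x z ^ Suc j \<partial>L) + (e \<bullet> (x - c)) * (\<integral>z. p z * bump R x z ^ Suc j \<partial>L)"
    if L: "locally_finite_borel L" for L
  proof -
    have "p z * (e \<bullet> (z - c)) * bump R x z ^ Suc j =
      p z * (e \<bullet> (z - x)) * bump R x z ^ Suc j + (e \<bullet> (x - c)) * (p z * bump R x z ^ Suc j)" for z
      by (simp add: algebra_simps)
    then show ?thesis
      using integrable_bump[OF L cont' less_imp_le[OF R(1)]] integrable_bump[OF L cont less_imp_le[OF R(1)]]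
      by (simp only: Bochner_Integration.integral_add integrable_mult_right integral_mult_right_zero)
  qed
  show "(\<integral>z. p z * (e \<bullet> (z - c)) * bump R x z ^ Suc j \<partial>M) = (\<integral>z. p z * (e \<bullet> (z - c)) * bump R x z ^ Suc j \<partial>N)"
    unfolding expand[OF M] expand[OF N] agrees_mult_inner_centre[OF p e x] agreesD[OF p x] ..
qed

text \<open>Where the bump is nonzero, \<open>(dist x z)\<^sup>2\<close> is \<open>R\<^sup>2\<close>
  minus the bump, so multiplying by it only raises the exponent. Passing from \<open>x\<close> to
  \<open>w\<close> adds a constant and a linear term in the direction \<open>w - x\<close>, which
  lies in \<open>T\<close>.\<close>

lemma agrees_mult_dist:
  assumes p: "agrees p" and w: "w - a \<in> T"
  shows "agrees (\<lambda>z. p z * (dist w z)\<^sup>2)"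
proof (rule agreesI)
  note cont = agrees_continuous[OF p]
  show "continuous_on UNIV (\<lambda>z. p z * (dist w z)\<^sup>2)"
    by (intro continuous_intros cont)
  fix x j assume x: "x - a \<in> T" "dist a x < \<epsilon>"
  define e where "e = w - x"
  have e: "e \<in> T"
    using subspace_diff[OF T w x(1)] by (simp add: e_def)
  have cont': "continuous_on UNIV (\<lambda>z. p z * (e \<bullet> (z - x)))"
    by (intro continuous_intros cont)
  have expand: "(\<integral>z. p z * (dist w z)\<^sup>2 * bump R x z ^ Suc j \<partial>L) =
      (R\<^sup>2 + (norm e)\<^sup>2) * (\<integral>z. p z * bump R x z ^ Suc j \<partial>L) + (-1) * (\<integral>z. p z * bump R x z ^ Suc (Suc j) \<partial>L)
      + (-2) * (\<integral>z. p z * (e \<bullet> (z - x)) * bump R x z ^ Suc j \<partial>L)"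
    if L: "locally_finite_borel L" for L
  proof -
    have "p z * (dist w z)\<^sup>2 * bump R x z ^ Suc j =
      (R\<^sup>2 + (norm e)\<^sup>2) * (p z * bump R x z ^ Suc j) + (-1) * (p z * bump R x z ^ Suc (Suc j))
      + (-2) * (p z * (e \<bullet> (z - x)) * bump R x z ^ Suc j)" for z
    proof (cases "bump R x z = 0")
      case False
      then have "(dist x z)\<^sup>2 = R\<^sup>2 - bump R x z"
        by (auto simp: bump_def max_def split: if_splits)
      moreover have "(dist w z)\<^sup>2 = (dist x z)\<^sup>2 - 2 * (e \<bullet> (z - x)) + (norm e)\<^sup>2"
        using dist_add_squared[of x 1 e z] by (simp add: e_def)
      ultimately show ?thesis
        by (simp only:) (simp add: algebra_simps)
    qed simp
    then show ?thesis
      using integrable_bump[OF L cont' less_imp_le[OF R(1)]] integrable_bump[OF L cont less_imp_le[OF R(1)]]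
      by (simp only: Bochner_Integration.integral_add Bochner_Integration.integrable_add
          integrable_mult_right integral_mult_right_zero)
  qed
  show "(\<integral>z. p z * (dist w z)\<^sup>2 * bump R x z ^ Suc j \<partial>M) = (\<integral>z. p z * (dist w z)\<^sup>2 * bump R x z ^ Suc j \<partial>N)"
    unfolding expand[OF M] expand[OF N] agrees_mult_inner_centre[OF p e x] agreesD[OF p x] ..
qed

lemma agrees_peak:
  assumes w: "w - a \<in> T"
  shows "agrees (\<lambda>z. (1 - (dist w z)\<^sup>2 / 4) ^ m)"
proof (induction m)
  case (Suc m)
  have "agrees (\<lambda>z. (1 - (dist w z)\<^sup>2 / 4) ^ m - (1 / 4) * ((1 - (dist w z)\<^sup>2 / 4) ^ m * (dist w z)\<^sup>2))"
    by (intro agrees_diff agrees_cmult agrees_mult_dist Suc w)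
  then show ?case
    by (simp add: algebra_simps)
qed (simp add: agrees_const)

lemma agreesD_centre:
  assumes "agrees p"
  shows "(\<integral>z. p z * bump R a z \<partial>M) = (\<integral>z. p z * bump R a z \<partial>N)"
  using agreesD[OF assms, of a 0] \<epsilon> subspace_0[OF T] by simp

lemma integrable_bump_centre:
  assumes "continuous_on UNIV p"
  shows "integrable M (\<lambda>z. p z * bump R a z)" "integrable N (\<lambda>z. p z * bump R a z)"
  using integrable_bump_MN[OF assms, of a 0] by simp_all

text \<open>The powers of \<open>1 - (dist w z)\<^sup>2 / 4\<close>, which lies between 0 and 1 on the ball around \<open>a\<close>
  since \<open>R \<le> 1\<close>, concentrate at \<open>w\<close>. If \<open>M\<close> vanished near \<open>w\<close>, the integrals against \<open>M\<close>
  would decay at a faster exponential rate than those against \<open>N\<close>.\<close>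

lemma supp_transfer:
  assumes w: "w - a \<in> T" "dist a w < R" "w \<in> supp_measure N"
  shows "w \<in> supp_measure M"
proof (rule ccontr)
  assume "w \<notin> supp_measure M"
  then obtain \<delta>0 where \<delta>0: "0 < \<delta>0" "emeasure M (ball w \<delta>0) = 0"
    by (auto simp: supp_measure_def)
  \<comment> \<open>The cap at 1 keeps the constant \<open>b\<close> below positive.\<close>
  define \<delta> where "\<delta> = min 1 \<delta>0"
  have \<delta>: "0 < \<delta>" "\<delta> \<le> 1" "ball w \<delta> \<subseteq> ball w \<delta>0"
    using \<delta>0 by (auto simp: \<delta>_def)
  have sM: "sets M = sets borel" and sN: "sets N = sets borel"
    using M N by (simp_all add: locally_finite_borel_def)
  have off: "AE z in M. z \<notin> ball w \<delta>"
    using \<delta>0 \<delta>(3) sM by (intro AE_I'[of "ball w \<delta>0"]) (auto intro!: null_setsI)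
  define q where "q z = 1 - (dist w z)\<^sup>2 / 4" for z
  \<comment> \<open>\<open>b\<close> bounds \<open>q\<close> from above off
    \<open>ball w \<delta>\<close>, and \<open>c\<close> bounds it from below on the ball of half
    that radius.\<close>
  define b c where "b = 1 - \<delta>\<^sup>2 / 4" and "c = 1 - (\<delta> / 2)\<^sup>2 / 4"
  have \<delta>2: "0 < \<delta>\<^sup>2" "\<delta>\<^sup>2 \<le> 1"
    using \<delta> by (simp_all add: power_le_one)
  then have bc: "0 < b" "b < c"
    by (auto simp: b_def c_def power_divide)
  have q_nonneg: "0 \<le> q z" if "dist a z < R" for z
  proof -
    have "dist w z \<le> 2"
      using that w(2) R dist_triangle3[of w z a] by (simp add: dist_commute)
    then have "(dist w z)\<^sup>2 \<le> 2\<^sup>2"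
      by (intro power_mono) auto
    then show ?thesis by (simp add: q_def)
  qed
  have contq: "continuous_on UNIV (\<lambda>z. q z ^ m)" for m
    unfolding q_def by (intro continuous_intros) auto
  have cont1: "continuous_on UNIV (\<lambda>z::'a. 1::real)"
    by simp
  \<comment> \<open>The second term keeps \<open>ball w \<delta>'\<close> away from the sphere of
    radius \<open>R\<close> around \<open>a\<close>, so that the bump is at least
    \<open>\<kappa>\<close> there.\<close>
  define \<delta>' where "\<delta>' = min (\<delta> / 2) ((R - dist a w) / 2)"
  have \<delta>': "0 < \<delta>'" "\<delta>' \<le> \<delta> / 2" "dist a w + \<delta>' \<le> (R + dist a w) / 2"
    using \<delta>(1) w(2) by (auto simp: \<delta>'_def min_def field_simps)
  define \<kappa> where "\<kappa> = R\<^sup>2 - ((R + dist a w) / 2)\<^sup>2"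
  have \<kappa>: "0 < \<kappa>"
    using w(2) R(1) by (simp add: \<kappa>_def power_strict_mono)
  have bump_ge: "\<kappa> \<le> bump R a z" if "z \<in> ball w \<delta>'" for z
  proof -
    have "dist a z \<le> (R + dist a w) / 2"
      using that \<delta>'(3) dist_triangle[of a z w] by simp
    then have "(dist a z)\<^sup>2 \<le> ((R + dist a w) / 2)\<^sup>2"
      by (intro power_mono) auto
    then show ?thesis by (simp add: bump_def \<kappa>_def)
  qed
  define mass where "mass = measure N (ball w \<delta>')"
  have fin: "emeasure N (ball w \<delta>') < \<infinity>"
  proof -
    have "emeasure N (ball w \<delta>') \<le> emeasure N (cball w \<delta>')"
      using sN by (intro emeasure_mono) auto
    also have "\<dots> < \<infinity>"
      using N by (simp add: locally_finite_borel_def)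
    finally show ?thesis .
  qed
  have mass: "0 < mass"
    using w(3) \<delta>'(1) fin by (auto simp: mass_def supp_measure_def measure_def enn2real_positive_iff)
  define tot where "tot = (\<integral>z. 1 * bump R a z \<partial>M)"
  have upper: "(\<integral>z. q z ^ m * bump R a z \<partial>M) \<le> b ^ m * tot" for m
  proof -
    have "(\<integral>z. q z ^ m * bump R a z \<partial>M) \<le> (\<integral>z. b ^ m * (1 * bump R a z) \<partial>M)"
    proof (rule integral_mono_AE)
      show "integrable M (\<lambda>z. q z ^ m * bump R a z)"
        by (rule integrable_bump_centre[OF contq])
      show "integrable M (\<lambda>z. b ^ m * (1 * bump R a z))"
        by (rule integrable_mult_right) (rule integrable_bump_centre[OF cont1])
      show "AE z in M. q z ^ m * bump R a z \<le> b ^ m * (1 * bump R a z)"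
        using off
      proof eventually_elim
        case (elim z)
        show ?case
        proof (cases "dist a z < R")
          case True
          have "\<delta>\<^sup>2 \<le> (dist w z)\<^sup>2"
            using elim \<delta>(1) by (intro power_mono) auto
          then have "q z \<le> b"
            by (simp add: q_def b_def)
          then show ?thesis
            using q_nonneg[OF True] by (simp add: bump_nonneg mult_right_mono power_mono)
        next
          case False
          then show ?thesis
            using bump_eq_0[of R a z] R(1) by simp
        qed
      qed
    qed
    also have "\<dots> = b ^ m * tot"
      by (simp only: tot_def integral_mult_right_zero)
    finally show ?thesis .
  qed
  have lower: "c ^ m * \<kappa> * mass \<le> (\<integral>z. q z ^ m * bump R a z \<partial>N)" for m
  proof -
    have "c ^ m * \<kappa> * mass = (\<integral>z. c ^ m * \<kappa> * indicator (ball w \<delta>') z \<partial>N)"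
      using sN sets_eq_imp_space_eq[OF sN] by (simp add: mass_def)
    also have "\<dots> \<le> (\<integral>z. q z ^ m * bump R a z \<partial>N)"
    proof (rule integral_mono)
      show "integrable N (\<lambda>z. c ^ m * \<kappa> * indicator (ball w \<delta>') z)"
        using fin sN by (intro integrable_mult_right integrable_real_indicator) auto
      show "integrable N (\<lambda>z. q z ^ m * bump R a z)"
        by (rule integrable_bump_centre[OF contq])
      fix z
      show "c ^ m * \<kappa> * indicator (ball w \<delta>') z \<le> q z ^ m * bump R a z"
      proof (cases "z \<in> ball w \<delta>'")
        case True
        then have "(dist w z)\<^sup>2 \<le> (\<delta> / 2)\<^sup>2"
          using \<delta>'(2) by (intro power_mono) auto
        then have "c \<le> q z"
          by (simp add: q_def c_def)
        then have "c ^ m * \<kappa> \<le> q z ^ m * bump R a z"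
          using bc \<kappa> bump_ge[OF True] by (intro mult_mono power_mono) auto
        then show ?thesis
          using True by simp
      next
        case False
        show ?thesis
        proof (cases "dist a z < R")
          case True
          then show ?thesis
            using False q_nonneg[OF True] by (simp add: bump_nonneg)
        next
          case far: False
          then show ?thesis
            using False bump_eq_0[of R a z] R(1) by simp
        qed
      qed
    qed
    finally show ?thesis .
  qed
  \<comment> \<open>After division by \<open>c ^ m\<close> the right side decays geometrically,
    while the left side is a fixed positive number.\<close>
  have ineq: "\<kappa> * mass \<le> (b / c) ^ m * tot" for m
  proof -
    have "(\<integral>z. q z ^ m * bump R a z \<partial>M) = (\<integral>z. q z ^ m * bump R a z \<partial>N)"
      unfolding q_def by (rule agreesD_centre[OF agrees_peak[OF w(1)]])
    then have "c ^ m * \<kappa> * mass \<le> b ^ m * tot"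
      using upper[of m] lower[of m] by linarith
    then show ?thesis
      using bc by (simp add: power_divide field_simps)
  qed
  have "(\<lambda>m. (b / c) ^ m * tot) \<longlonglongrightarrow> 0 * tot"
    using bc by (intro tendsto_mult_right LIMSEQ_realpow_zero) auto
  then have "\<kappa> * mass \<le> 0 * tot"
    by (rule LIMSEQ_le_const) (use ineq in blast)
  then show False
    using mult_pos_pos[OF \<kappa> mass] by simp
qed

text \<open>The squared distance from \<open>z\<close> to the plane is an admissible weight, and its integral
  against \<open>N\<close> vanishes.\<close>

lemma supp_subset_plane:
  assumes N_plane: "\<And>z. z \<in> supp_measure N \<Longrightarrow> dist a z < R \<Longrightarrow> z - a \<in> T"
    and w: "w \<in> supp_measure M" "dist a w < R"
  shows "w - a \<in> T"
proof -
  obtain B where B: "B \<subseteq> T" "pairwise orthogonal B" "\<And>e. e \<in> B \<Longrightarrow> norm e = 1"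
      "independent B" "span B = T"
    using orthonormal_basis_subspace[OF T] by metis
  have finB: "finite B"
    using B(4) independent_imp_finite by blast
  have sM: "sets M = sets borel" and sN: "sets N = sets borel"
    using M N by (simp_all add: locally_finite_borel_def)
  \<comment> \<open>By \<open>bessel\<close>, the squared distance from \<open>z\<close> to
    \<open>a + T\<close>. The factors 1 bring it into the product form of the closure rules for
    \<open>agrees\<close>.\<close>
  define p where "p z = 1 * (dist a z)\<^sup>2 - (\<Sum>e\<in>B. 1 * (e \<bullet> (z - a)) * (e \<bullet> (z - a)))" for z
  have agree: "agrees p"
    unfolding p_def using B(1) subspace_0[OF T]
    by (intro agrees_diff agrees_mult_dist agrees_sum agrees_mult_inner agrees_const) auto
  have p_eq: "p z = (norm ((z - a) - (\<Sum>e\<in>B. (e \<bullet> (z - a)) *\<^sub>R e)))\<^sup>2" for z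
  proof -
    have "p z = (norm (z - a))\<^sup>2 - (\<Sum>e\<in>B. (e \<bullet> (z - a))\<^sup>2)"
      by (simp add: p_def dist_norm norm_minus_commute power2_eq_square)
    then show ?thesis
      using bessel[OF finB B(2,3), of "z - a"] by simp
  qed
  have p_0: "p z = 0" if "z - a \<in> T" for z
  proof -
    let ?v = "(z - a) - (\<Sum>e\<in>B. (e \<bullet> (z - a)) *\<^sub>R e)"
    have "?v \<in> span B"
      unfolding B(5) using B(1)
      by (intro subspace_diff[OF T that] subspace_sum[OF T] subspace_scale[OF T]) auto
    moreover have "orthogonal ?v e" if "e \<in> B" for e
    proof -
      have "(\<Sum>f\<in>B. (f \<bullet> (z - a)) * (f \<bullet> e)) = (\<Sum>f\<in>B. if f = e then e \<bullet> (z - a) else 0)"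
        by (intro sum.cong refl)
          (use that B(2,3) in \<open>auto simp: pairwise_def orthogonal_def dot_square_norm\<close>)
      also have "\<dots> = (z - a) \<bullet> e"
        using finB that by (simp add: inner_commute)
      finally show ?thesis
        by (simp add: orthogonal_def inner_diff_left inner_sum_left)
    qed
    \<comment> \<open>The residual of the projection lies in \<open>span B\<close> and is orthogonal
      to \<open>B\<close>, hence to itself.\<close>
    ultimately have "orthogonal ?v ?v"
      by (rule orthogonal_to_span)
    then show ?thesis
      unfolding p_eq by (simp add: orthogonal_def)
  qed
  have "AE z in N. p z * bump R a z = 0"
    using AE_in_supp_measure[OF sN]
  proof eventually_elim
    case (elim z)
    then show ?case
      using p_0[of z] N_plane[of z] bump_eq_0[of R a z] R(1) by (cases "dist a z < R") auto
  qed
  then have "(\<integral>z. p z * bump R a z \<partial>M) = 0"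
    unfolding agreesD_centre[OF agree] by (rule integral_eq_zero_AE)
  moreover have "continuous_on UNIV (\<lambda>z. p z * bump R a z)"
    by (intro continuous_intros agrees_continuous[OF agree])
  moreover have "0 \<le> p z * bump R a z" for z
    by (simp add: p_eq bump_nonneg)
  ultimately have "p w * bump R a w = 0"
    using integral_zero_imp_zero_on_supp[OF sM, of "\<lambda>z. p z * bump R a z", OF _ _ _ _ w(1)]
      integrable_bump_centre(1)[OF agrees_continuous[OF agree]] by blast
  then have "p w = 0"
    using bump_pos[OF w(2)] by simp
  then have "w - a = (\<Sum>e\<in>B. (e \<bullet> (w - a)) *\<^sub>R e)"
    by (simp add: p_eq)
  also have "\<dots> \<in> T"
    using B(1) by (intro subspace_sum[OF T] subspace_scale[OF T]) auto
  finally show ?thesis .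
qed

end

section \<open>Bump integrals for uniformly distributed measures and translates\<close>

lemma locally_uniformly_distributed_locally_finite:
  assumes "locally_uniformly_distributed \<mu>"
  shows "locally_finite_borel \<mu>"
proof -
  have "radon_measure \<mu>"
    using assms unfolding locally_uniformly_distributed_def by (rule conjunct1)
  then have "sets \<mu> = sets borel \<and> (\<forall>K. compact K \<longrightarrow> emeasure \<mu> K < \<infinity>)"
    unfolding radon_measure_def by (elim conjE) (rule conjI)
  then show ?thesis
    unfolding locally_finite_borel_def by simp
qed

lemma locally_uniformly_distributedD:
  assumes "locally_uniformly_distributed \<mu>" "x \<in> supp_measure \<mu>" "y \<in> supp_measure \<mu>" "0 < r" "r \<le> 1"
  shows "emeasure \<mu> (ball x r) = emeasure \<mu> (ball y r)" "emeasure \<mu> (ball x r) < \<infinity>"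
  using assms unfolding locally_uniformly_distributed_def by blast+

text \<open>The bump depends on \<open>z\<close> only through its distance to the centre, so its
  integrals are determined by the masses of concentric balls of radius at most
  \<open>R \<le> 1\<close>, which agree at all points of the support.\<close>

lemma integral_bump_eq_on_supp:
  fixes \<mu> :: "'a::euclidean_space measure"
  assumes \<mu>: "locally_uniformly_distributed \<mu>" and R: "0 < R" "R \<le> 1"
    and x: "x \<in> supp_measure \<mu>" and y: "y \<in> supp_measure \<mu>"
  shows "(\<integral>z. bump R x z ^ Suc j \<partial>\<mu>) = (\<integral>z. bump R y z ^ Suc j \<partial>\<mu>)"
proof -
  have sets: "sets \<mu> = sets borel"
    using locally_uniformly_distributed_locally_finite[OF \<mu>] by (simp add: locally_finite_borel_def)
  have space: "space \<mu> = UNIV"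
    using sets_eq_imp_space_eq[OF sets] by simp
  have meas: "f \<in> borel_measurable \<mu>" if "continuous_on UNIV f" for f :: "'a \<Rightarrow> real"
    using locally_finite_borel_measurable[OF locally_uniformly_distributed_locally_finite[OF \<mu>] that] .
  \<comment> \<open>Restricting to the ball limits the radii to the range where uniformity applies
    and makes the pushforward finite.\<close>
  define L where "L u = density \<mu> (indicator (ball u R))" for u
  \<comment> \<open>The minus sign turns open balls into preimages of the rays
    \<open>{t<..}\<close>, on which \<open>measure_eqI_lessThan\<close> compares measures.\<close>
  define D where "D u = distr (L u) borel (\<lambda>z. - dist u z)" for u
  have dist_meas: "(\<lambda>z. - dist u z) \<in> borel_measurable (L u)" for u
    unfolding L_def by (simp add: meas continuous_intros)
  have D_greaterThan: "emeasure (D u) {t<..} = emeasure \<mu> (ball u (min R (- t)))" for u t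
  proof -
    have "emeasure (D u) {t<..} = emeasure (L u) (ball u (- t))"
      unfolding D_def using dist_meas
      by (subst emeasure_distr) (auto simp: L_def space intro!: arg_cong2[where f = emeasure])
    also have "\<dots> = emeasure \<mu> (ball u R \<inter> ball u (- t))"
      unfolding L_def using sets by (intro emeasure_restricted) auto
    also have "ball u R \<inter> ball u (- t) = ball u (min R (- t))"
      by auto
    finally show ?thesis .
  qed
  have fin: "emeasure \<mu> (ball u (min R (- t))) < \<infinity>" if "u \<in> supp_measure \<mu>" for u t
  proof (cases "t < 0")
    case True
    then show ?thesis
      using locally_uniformly_distributedD(2)[OF \<mu> that that] R by simp
  qed (simp add: ball_empty)
  have "D x = D y"
  proof (rule measure_eqI_lessThan)
    show "sets (D x) = sets borel" "sets (D y) = sets borel"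
      by (simp_all add: D_def)
    show "emeasure (D x) {t<..} < \<infinity>" for t
      unfolding D_greaterThan by (rule fin[OF x])
    show "emeasure (D x) {t<..} = emeasure (D y) {t<..}" for t
    proof (cases "t < 0")
      case True
      then have "0 < min R (- t)" "min R (- t) \<le> 1"
        using R by auto
      then show ?thesis
        unfolding D_greaterThan by (rule locally_uniformly_distributedD(1)[OF \<mu> x y])
    qed (simp add: D_greaterThan ball_empty)
  qed
  moreover have "(\<integral>z. bump R u z ^ Suc j \<partial>\<mu>) = (\<integral>s. (max 0 (R\<^sup>2 - s\<^sup>2)) ^ Suc j \<partial>D u)" for u
  proof -
    have "(\<integral>s. (max 0 (R\<^sup>2 - s\<^sup>2)) ^ Suc j \<partial>D u) = (\<integral>z. (max 0 (R\<^sup>2 - (- dist u z)\<^sup>2)) ^ Suc j \<partial>L u)"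
      unfolding D_def
      by (rule integral_distr[OF dist_meas]) (intro borel_measurable_continuous_onI continuous_intros)
    also have "\<dots> = (\<integral>z. bump R u z ^ Suc j \<partial>density \<mu> (\<lambda>z. ennreal (indicator (ball u R) z)))"
      by (simp only: L_def bump_def power2_minus ennreal_indicator)
    also have "\<dots> = (\<integral>z. indicator (ball u R) z *\<^sub>R bump R u z ^ Suc j \<partial>\<mu>)"
      using sets by (intro integral_density borel_measurable_indicator meas continuous_intros) auto
    also have "\<dots> = (\<integral>z. bump R u z ^ Suc j \<partial>\<mu>)"
      using R(1) bump_eq_0[of R u]
      by (intro Bochner_Integration.integral_cong) (auto simp: indicator_def not_less)
    finally show ?thesis ..
  qed
  ultimately show ?thesis by simp
qed

lemma
  fixes \<mu> :: "'a::euclidean_space measure"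
    and f :: "'a \<Rightarrow> real"
  assumes \<mu>: "locally_finite_borel \<mu>"
  shows integral_translated: "continuous_on UNIV f \<Longrightarrow>
      (\<integral>z. f z \<partial>distr \<mu> borel (\<lambda>z. z + c)) = (\<integral>z. f (z + c) \<partial>\<mu>)"
    and locally_finite_borel_translated: "locally_finite_borel (distr \<mu> borel (\<lambda>z. z + c))"
    and supp_measure_translated: "w \<in> supp_measure (distr \<mu> borel (\<lambda>z. z + c)) \<longleftrightarrow> w - c \<in> supp_measure \<mu>"
proof -
  have sets: "sets \<mu> = sets borel"
    using \<mu> by (simp add: locally_finite_borel_def)
  have meas: "(\<lambda>z. z + c) \<in> measurable \<mu> borel"
    using sets measurable_cong_sets[of \<mu> borel borel borel] by simp
  have space: "space \<mu> = UNIV"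
    using sets_eq_imp_space_eq[OF sets] by simp
  have em: "emeasure (distr \<mu> borel (\<lambda>z. z + c)) A = emeasure \<mu> ((\<lambda>z. z + c) -` A)" if "A \<in> sets borel" for A
    using emeasure_distr[OF meas that] by (simp add: space)
  have balls: "(\<lambda>z. z + c) -` ball x r = ball (x - c) r" "(\<lambda>z. z + c) -` cball x r = cball (x - c) r" for x r
    by (auto simp: dist_norm algebra_simps)
  show "(\<integral>z. f z \<partial>distr \<mu> borel (\<lambda>z. z + c)) = (\<integral>z. f (z + c) \<partial>\<mu>)" if "continuous_on UNIV f"
    using that by (intro integral_distr meas borel_measurable_continuous_onI)
  show "locally_finite_borel (distr \<mu> borel (\<lambda>z. z + c))"
    using \<mu> by (simp add: locally_finite_borel_def em balls)
  show "w \<in> supp_measure (distr \<mu> borel (\<lambda>z. z + c)) \<longleftrightarrow> w - c \<in> supp_measure \<mu>"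
    by (simp add: supp_measure_def em balls)
qed

section \<open>Flat balls of uniform radius and connected components\<close>

text \<open>The radius \<open>R\<close> in the conclusion does not depend on \<open>\<epsilon>\<close>. The comparison measure is the
  translate of \<open>\<mu>\<close> moving \<open>z0\<close> to \<open>a\<close>, whose support near \<open>a\<close> is known to be the plane.\<close>

lemma flat_ball_radius:
  fixes \<mu> :: "'a::euclidean_space measure"
  assumes \<mu>: "locally_uniformly_distributed \<mu>" and R: "0 < R" "R \<le> 1" and T: "subspace T"
    and flat: "\<And>z. dist z0 z < R \<Longrightarrow> z \<in> supp_measure \<mu> \<longleftrightarrow> z - z0 \<in> T"
    and \<epsilon>: "0 < \<epsilon>" and a: "\<And>x. x - a \<in> T \<Longrightarrow> dist a x < \<epsilon> \<Longrightarrow> x \<in> supp_measure \<mu>"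
    and w: "dist a w < R"
  shows "w \<in> supp_measure \<mu> \<longleftrightarrow> w - a \<in> T"
proof -
  define c where "c = a - z0"
  define N where "N = distr \<mu> borel (\<lambda>z. z + c)"
  note lf = locally_uniformly_distributed_locally_finite[OF \<mu>]
  have supp_N: "z \<in> supp_measure N \<longleftrightarrow> z - a \<in> T" if "dist a z < R" for z
    using flat[of "z - c"] that unfolding N_def supp_measure_translated[OF lf]
    by (simp add: c_def dist_norm algebra_simps)
  \<comment> \<open>Centres closer than \<open>\<epsilon>\<close> lie in the support of
    \<open>\<mu>\<close>, those closer than \<open>R\<close> in the support of \<open>N\<close>;
    both are required to compare the integrals.\<close>
  interpret equal_bump_integrals \<mu> N R T a "min \<epsilon> R"
  proof
    show "locally_finite_borel \<mu>" "locally_finite_borel N"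
      using lf locally_finite_borel_translated[OF lf] by (simp_all add: N_def)
    show "0 < R" "R \<le> 1" "subspace T" "0 < min \<epsilon> R"
      using R T \<epsilon> by auto
    fix x j assume x: "x - a \<in> T" "dist a x < min \<epsilon> R"
    have "(\<integral>z. bump R x z ^ Suc j \<partial>N) = (\<integral>z. bump R x (z + c) ^ Suc j \<partial>\<mu>)"
      unfolding N_def by (intro integral_translated[OF lf] continuous_intros)
    also have "\<dots> = (\<integral>z. bump R (x - c) z ^ Suc j \<partial>\<mu>)"
      by (simp add: bump_def dist_norm algebra_simps)
    also have "\<dots> = (\<integral>z. bump R x z ^ Suc j \<partial>\<mu>)"
    proof (rule integral_bump_eq_on_supp[OF \<mu> R])
      show "x \<in> supp_measure \<mu>"
        using a x by simp
      show "x - c \<in> supp_measure \<mu>"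
        using supp_N[of x] x unfolding N_def supp_measure_translated[OF lf] by simp
    qed
    finally show "(\<integral>z. bump R x z ^ Suc j \<partial>\<mu>) = (\<integral>z. bump R x z ^ Suc j \<partial>N)" ..
  qed
  show ?thesis
    using supp_transfer[of w] supp_subset_plane[of w] supp_N w by blast
qed

text \<open>The uniform radius makes the good points clopen in the connected set \<open>P\<close>,
  so \<open>P\<close> lies in the support. The same radius makes \<open>P\<close> open in any larger
  connected subset \<open>C\<close> of the support, and \<open>P\<close> is closed, so
  \<open>C = P\<close>.\<close>

lemma plane_in_components_supp:
  fixes \<mu> :: "'a::euclidean_space measure"
  assumes \<mu>: "locally_uniformly_distributed \<mu>" and P: "affine P"
    and z0: "z0 \<in> supp_measure \<mu>" and r0: "0 < r0"
    and flat: "ball z0 r0 \<inter> supp_measure \<mu> = ball z0 r0 \<inter> P"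
  shows "P \<in> components (supp_measure \<mu>)"
proof -
  let ?\<Sigma> = "supp_measure \<mu>"
  define R where "R = min 1 r0"
  have R: "0 < R" "R \<le> 1" "R \<le> r0"
    using r0 by (auto simp: R_def)
  have z0P: "z0 \<in> P"
    using z0 r0 flat by (metis IntD2 IntI centre_in_ball)
  define T where "T = (\<lambda>x. x - z0) ` P"
  have T: "subspace T"
    unfolding T_def using P z0P by (rule affine_diffs_subspace_subtract)
  have diff_T: "x - a \<in> T \<longleftrightarrow> x \<in> P" if "a \<in> P" for a x
  proof -
    have "a - z0 \<in> T" "x - z0 \<in> T \<longleftrightarrow> x \<in> P"
      using that by (auto simp: T_def)
    moreover have "x - z0 = (x - a) + (a - z0)" "x - a = (x - z0) - (a - z0)"
      by simp_all
    ultimately show ?thesis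
      using subspace_add[OF T] subspace_diff[OF T] by metis
  qed
  have flat_R: "z \<in> ?\<Sigma> \<longleftrightarrow> z - z0 \<in> T" if "dist z0 z < R" for z
    using that R(3) flat diff_T[OF z0P] by (auto simp: set_eq_iff)
  define A where "A = {a \<in> P. ball a R \<inter> P \<subseteq> ?\<Sigma>}"
  \<comment> \<open>Self-improvement: a neighbourhood of arbitrary size \<open>\<epsilon>\<close> is
    upgraded to the fixed radius \<open>R\<close>, and inclusion to equality.\<close>
  have step: "ball a R \<inter> ?\<Sigma> = ball a R \<inter> P"
    if "a \<in> P" "0 < \<epsilon>" "ball a \<epsilon> \<inter> P \<subseteq> ?\<Sigma>" for a \<epsilon>
  proof -
    have "x \<in> ?\<Sigma>" if "x - a \<in> T" "dist a x < \<epsilon>" for x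
      using that \<open>ball a \<epsilon> \<inter> P \<subseteq> ?\<Sigma>\<close> diff_T[OF \<open>a \<in> P\<close>] by auto
    then have "w \<in> ?\<Sigma> \<longleftrightarrow> w \<in> P" if "dist a w < R" for w
      using flat_ball_radius[OF \<mu> R(1,2) T flat_R \<open>0 < \<epsilon>\<close> _ that] diff_T[OF \<open>a \<in> P\<close>] by blast
    then show ?thesis by auto
  qed
  have spread: "b \<in> A" if "a \<in> A" "b \<in> P" "dist a b < R" for a b
  proof -
    have "ball b (R - dist a b) \<subseteq> ball a R"
    proof
      fix z assume "z \<in> ball b (R - dist a b)"
      then show "z \<in> ball a R"
        using dist_triangle[of a z b] by simp
    qed
    then have "ball b (R - dist a b) \<inter> P \<subseteq> ?\<Sigma>"
      using that(1) by (auto simp: A_def)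
    then show ?thesis
      using step[of b "R - dist a b"] that by (auto simp: A_def)
  qed
  have "A = P"
  proof -
    have "openin (top_of_set P) A"
      unfolding openin_euclidean_subtopology_iff
      using spread R(1) by (auto simp: A_def dist_commute)
    \<comment> \<open>A limit point of \<open>A\<close> is within \<open>R\<close> of some good
      point, so \<open>spread\<close> reaches it.\<close>
    moreover have "closedin (top_of_set P) A"
    proof (rule closedin_limpt[THEN iffD2], intro conjI allI impI)
      show "A \<subseteq> P" by (auto simp: A_def)
      fix b assume "b islimpt A \<and> b \<in> P"
      then obtain a where "a \<in> A" "dist a b < R"
        using R(1) by (auto simp: islimpt_approachable)
      then show "b \<in> A"
        using spread \<open>b islimpt A \<and> b \<in> P\<close> by blast
    qed
    moreover have "z0 \<in> A"
      using z0P by (auto simp: A_def flat_R diff_T)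
    ultimately show ?thesis
      using connected_clopen[THEN iffD1, OF convex_connected[OF affine_imp_convex[OF P]]] by blast
  qed
  then have P_sub: "P \<subseteq> ?\<Sigma>"
    using R(1) by (force simp: A_def)
  show ?thesis
    unfolding in_components_maximal
  proof (intro conjI allI impI)
    show "P \<noteq> {}" using z0P by blast
    show "connected P" using P by (simp add: affine_imp_convex convex_connected)
    fix C assume C: "C \<noteq> {} \<and> P \<subseteq> C \<and> C \<subseteq> ?\<Sigma> \<and> connected C"
    have "openin (top_of_set C) P"
      unfolding openin_euclidean_subtopology_iff
    proof (intro conjI ballI)
      show "P \<subseteq> C" using C by blast
      fix x assume "x \<in> P"
      then have "ball x R \<inter> ?\<Sigma> = ball x R \<inter> P"
        using step[of x R] R(1) P_sub by blast
      moreover have "x' \<in> ball x R \<inter> ?\<Sigma>" if "x' \<in> C" "dist x' x < R" for x'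
        using that C by (auto simp: dist_commute)
      ultimately show "\<exists>e>0. \<forall>x'\<in>C. dist x' x < e \<longrightarrow> x' \<in> P"
        using R(1) by blast
    qed
    moreover have "closed P"
      using closed_affine_hull[of P] by (simp add: affine_hull_eq[THEN iffD2, OF P])
    then have "closedin (top_of_set C) P"
      using C by (simp add: closed_subset)
    moreover have "connected C"
      using C by blast
    ultimately have "P = {} \<or> P = C"
      by (simp add: connected_clopen)
    then show "C = P"
      using z0P by blast
  qed (rule P_sub)
qed

theorem theorem1p2:
  fixes n k :: nat
    and \<mu> :: "(real ^ 'n) measure"
    and z\<^sub>0 :: "real ^ 'n"
    and r\<^sub>0 :: real
    and P :: "(real ^ 'n) set"
  assumes "CARD('n) = n + 1"
    and "k \<le> n + 1"
    and "locally_uniformly_distributed \<mu>"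
    and "z\<^sub>0 \<in> supp_measure \<mu>"
    and "r\<^sub>0 > 0"
    and "k_plane k P"
    and "ball z\<^sub>0 r\<^sub>0 \<inter> supp_measure \<mu> = ball z\<^sub>0 r\<^sub>0 \<inter> P"
  shows "(\<exists>!C. C \<in> components (supp_measure \<mu>) \<and> C \<inter> ball z\<^sub>0 r\<^sub>0 \<noteq> {}) \<and>
         (\<forall>C. C \<in> components (supp_measure \<mu>) \<and> C \<inter> ball z\<^sub>0 r\<^sub>0 \<noteq> {} \<longrightarrow> C = P)"
proof -
  have P: "P \<in> components (supp_measure \<mu>)"
    using assms(6) by (intro plane_in_components_supp[OF assms(3) _ assms(4,5,7)]) (simp add: k_plane_def)
  have "z\<^sub>0 \<in> ball z\<^sub>0 r\<^sub>0 \<inter> P"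
    using assms(4,5) unfolding assms(7)[symmetric] by simp
  then have "P \<inter> ball z\<^sub>0 r\<^sub>0 \<noteq> {}"
    by blast
  \<comment> \<open>Inside the ball the support is \<open>P\<close>, so such a \<open>C\<close>
    meets \<open>P\<close>, and components that meet coincide.\<close>
  moreover have "C = P" if "C \<in> components (supp_measure \<mu>)" "C \<inter> ball z\<^sub>0 r\<^sub>0 \<noteq> {}" for C
  proof -
    have "C \<inter> P \<noteq> {}"
      using that assms(7) in_components_subset[OF that(1)] by blast
    then show ?thesis
      using components_eq[OF that(1) P] by blast
  qed
  ultimately show ?thesis
    using P by blast
qed

end
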